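(* Let $G$ be a finite abelian group with dual group $\hat G$, and let $\mathcal S\subseteq\hat G$ be symmetric (i.e. $\chi\in\mathcal S\Rightarrow\chi^{-1}\in\mathcal S$). Let $\Gamma$ be a chordal cover of $\mathrm{Cay}(\hat G,\mathcal S)$, for each maximal clique $\mathcal C$ of $\Gamma$ let $\chi_{\mathcal C}\in\hat G$, and let $\mathcal T=\bigcup_{\mathcal C}\chi_{\mathcal C}\,\mathcal C$, where the union is over all maximal cliques of $\Gamma$ and $\chi_{\mathcal C}\,\mathcal C=\{\chi_{\mathcal C}\chi:\chi\in\mathcal C\}$. Then the moment polytope $\mathcal M(G,\mathcal S)$ satisfies $$\mathcal M(G,\mathcal S)=\Bigl\{(\ell_\chi)_{\chi\in\mathcal S}\in\mathbb C^{\mathcal S}:\ \exists\,(y_\chi)_{\chi\in\mathcal T^{-1}\mathcal T}\in\mathbb C^{\mathcal T^{-1}\mathcal T}\ \text{such that } y_\chi=\ell_\chi\ \forall\chi\in\mathcal S,\ y_{1_{\hat G}}=1,\ \text{and } [y_{\bar\chi\chi'}]_{\chi,\chi'\in\mathcal T}\succeq 0\Bigr\}.$$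
   Context: $\hat G$ is the group (under pointwise multiplication) of characters of $G$, i.e. homomorphisms $G\to\mathbb C^*$, with identity $1_{\hat G}$ (the constant function 1) and inverse $\chi^{-1}=\bar\chi$. $\mathcal T^{-1}\mathcal T=\{\bar\chi\chi':\chi,\chi'\in\mathcal T\}$; under the hypotheses $\mathcal S\subseteq\mathcal T^{-1}\mathcal T$. The notation $M\succeq 0$ means that $M$ is Hermitian positive semidefinite (in particular Hermitian). The moment polytope is $\mathcal M(G,\mathcal S)=\{(\mathbb E_{x\sim\mu}[\chi(x)])_{\chi\in\mathcal S}\in\mathbb C^{\mathcal S}:\mu\text{ a probability measure on }G\}=\mathrm{conv}\{(\chi(x))_{\chi\in\mathcal S}:x\in G\}$. $\mathrm{Cay}(\hat G,\mathcal S)$ is the simple graph with vertex set $\hat G$ in which distinct $\chi,\chi'$ are adjacent iff $\chi^{-1}\chi'\in\mathcal S$. A graph is chordal if every cycle of length at least four has a chord; a chordal cover of $(V,E)$ is a chordal graph $(V,E')$ with $E\subseteq E'$. A maximal clique is a clique not strictly contained in another clique. *)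

theory Defs
  imports
    "HOL-Probability.Probability"
    "HOL-Algebra.Multiplicative_Group"
    "HOL-Library.Ramsey"
begin

section \<open>Characters and the dual group\<close>

definition complex_units :: "complex monoid" where
  "complex_units = \<lparr>carrier = UNIV - {0}, mult = (*), one = 1\<rparr>"

text \<open>A character is a function on \<open>carrier G\<close>; it is made \<open>undefined\<close> outside the carrier so
  that equality of characters is equality of HOL functions.\<close>

definition dual_group :: "('a, 'b) monoid_scheme \<Rightarrow> ('a \<Rightarrow> complex) monoid" where
  "dual_group G =
     \<lparr>carrier = hom G complex_units \<inter> extensional (carrier G),
      mult = (\<lambda>\<psi> \<xi>. \<lambda>x\<in>carrier G. \<psi> x * \<xi> x),
      one = (\<lambda>x\<in>carrier G. 1)\<rparr>"

lemma carrier_dual_group: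
  "carrier (dual_group G) = hom G complex_units \<inter> extensional (carrier G)"
  by (simp add: dual_group_def)

lemma mult_dual_group:
  "\<psi> \<otimes>\<^bsub>dual_group G\<^esub> \<xi> = (\<lambda>x\<in>carrier G. \<psi> x * \<xi> x)"
  by (simp add: dual_group_def)

lemma one_dual_group: "\<one>\<^bsub>dual_group G\<^esub> = (\<lambda>x\<in>carrier G. 1)"
  by (simp add: dual_group_def)

lemma mem_dual_group_iff:
  "\<psi> \<in> carrier (dual_group G) \<longleftrightarrow>
     \<psi> \<in> extensional (carrier G) \<and> (\<forall>x\<in>carrier G. \<psi> x \<noteq> 0) \<and>
     (\<forall>x\<in>carrier G. \<forall>y\<in>carrier G. \<psi> (x \<otimes>\<^bsub>G\<^esub> y) = \<psi> x * \<psi> y)"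
  by (auto simp: carrier_dual_group hom_def complex_units_def Pi_iff)

lemma comm_group_dual_group:
  fixes G (structure)
  assumes "group G"
  shows "comm_group (dual_group G)"
proof (rule comm_groupI)
  interpret group G by fact
  fix \<psi> assume \<psi>: "\<psi> \<in> carrier (dual_group G)"
  show "\<one>\<^bsub>dual_group G\<^esub> \<otimes>\<^bsub>dual_group G\<^esub> \<psi> = \<psi>"
    using \<psi> by (auto simp: mult_dual_group one_dual_group mem_dual_group_iff extensional_def)
  show "\<exists>\<xi>\<in>carrier (dual_group G). \<xi> \<otimes>\<^bsub>dual_group G\<^esub> \<psi> = \<one>\<^bsub>dual_group G\<^esub>"
    using \<psi>
    by (intro bexI[of _ "\<lambda>x\<in>carrier G. inverse (\<psi> x)"])
       (auto simp: mult_dual_group one_dual_group mem_dual_group_iff)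
next
  interpret group G by fact
  show "\<one>\<^bsub>dual_group G\<^esub> \<in> carrier (dual_group G)"
    by (auto simp: one_dual_group mem_dual_group_iff)
  fix \<psi> \<xi> assume "\<psi> \<in> carrier (dual_group G)" "\<xi> \<in> carrier (dual_group G)"
  then show "\<psi> \<otimes>\<^bsub>dual_group G\<^esub> \<xi> \<in> carrier (dual_group G)"
    by (auto simp: mult_dual_group mem_dual_group_iff)
qed (auto simp: mult_dual_group mult_ac fun_eq_iff)

lemma dual_group_power_order:
  fixes G (structure)
  assumes "group G" and \<psi>: "\<psi> \<in> carrier (dual_group G)" and x: "x \<in> carrier G"
  shows "\<psi> x ^ order G = 1"
proof -
  interpret group G by fact
  have one: "\<psi> \<one> = 1"
    using \<psi> by (metis mem_dual_group_iff mult_cancel_right2 one_closed r_one)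
  have "\<psi> (x [^] n) = \<psi> x ^ n" for n :: nat
    using x \<psi> by (induction n) (auto simp: one mem_dual_group_iff)
  then show ?thesis
    using pow_order_eq_1[OF x] one by metis
qed

lemma finite_dual_group:
  assumes "group G" "finite (carrier G)"
  shows "finite (carrier (dual_group G))"
proof (rule finite_subset)
  interpret group G by fact
  have "order G > 0"
    using assms(2) by (simp add: order_gt_0_iff_finite)
  then have "finite {z :: complex. z ^ order G = 1}"
    by (intro finite_roots_unity) simp
  then show "finite (carrier G \<rightarrow>\<^sub>E {z :: complex. z ^ order G = 1})"
    using assms(2) by (intro finite_PiE) auto
  show "carrier (dual_group G) \<subseteq> carrier G \<rightarrow>\<^sub>E {z :: complex. z ^ order G = 1}"
    using dual_group_power_order[OF assms(1)]
    by (auto simp: PiE_def mem_dual_group_iff)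
qed

lemma inv_dual_group:
  fixes G (structure)
  assumes "group G" "finite (carrier G)" and \<psi>: "\<psi> \<in> carrier (dual_group G)"
  shows "inv\<^bsub>dual_group G\<^esub> \<psi> = (\<lambda>x\<in>carrier G. cnj (\<psi> x))"
proof -
  interpret group G by fact
  interpret D: comm_group "dual_group G" using comm_group_dual_group[OF assms(1)] .
  have unit: "\<psi> x * cnj (\<psi> x) = 1" if x: "x \<in> carrier G" for x
  proof -
    have "\<psi> x ^ order G = 1"
      using dual_group_power_order[OF assms(1) \<psi> x] .
    moreover have "order G > 0"
      using assms(2) by (simp add: order_gt_0_iff_finite)
    ultimately have "norm (\<psi> x) = 1"
      by (metis norm_power norm_one norm_ge_zero power_eq_1_iff neq0_conv real_norm_def abs_of_nonneg)
    then show ?thesis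
      by (simp add: complex_norm_square[symmetric])
  qed
  show ?thesis
  proof (rule D.inv_equality)
    show "(\<lambda>x\<in>carrier G. cnj (\<psi> x)) \<otimes>\<^bsub>dual_group G\<^esub> \<psi> = \<one>\<^bsub>dual_group G\<^esub>"
      using unit by (auto simp: mult_dual_group one_dual_group fun_eq_iff mult.commute)
    show "(\<lambda>x\<in>carrier G. cnj (\<psi> x)) \<in> carrier (dual_group G)"
      using \<psi> by (auto simp: mem_dual_group_iff)
  qed (fact \<psi>)
qed

section \<open>The moment polytope\<close>

text \<open>The space of complex vectors indexed by \<open>S\<close> is \<open>S \<rightarrow>\<^sub>E UNIV\<close>.\<close>

definition moment_polytope ::
    "('a, 'b) monoid_scheme \<Rightarrow> ('a \<Rightarrow> complex) set \<Rightarrow> (('a \<Rightarrow> complex) \<Rightarrow> complex) set" where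
  "moment_polytope G S =
     {(\<lambda>\<psi>\<in>S. measure_pmf.expectation \<mu> \<psi>) | \<mu> :: 'a pmf. set_pmf \<mu> \<subseteq> carrier G}"

section \<open>Simple graphs\<close>

text \<open>A simple graph on the vertex set \<open>V\<close> is given by its set \<open>E \<subseteq> [V]\<^bsup>2\<^esup>\<close> of
  two-element edges.\<close>

definition cayley_graph :: "('c, 'd) monoid_scheme \<Rightarrow> 'c set \<Rightarrow> 'c set set" where
  "cayley_graph H S =
     {{x, y} | x y. x \<in> carrier H \<and> y \<in> carrier H \<and> x \<noteq> y \<and> inv\<^bsub>H\<^esub> x \<otimes>\<^bsub>H\<^esub> y \<in> S}"

definition graph_cycle :: "'v set set \<Rightarrow> 'v list \<Rightarrow> bool" where
  "graph_cycle E vs \<longleftrightarrow> length vs \<ge> 3 \<and> distinct vs \<and>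
     (\<forall>i<length vs. {vs ! i, vs ! (Suc i mod length vs)} \<in> E)"

definition has_chord :: "'v set set \<Rightarrow> 'v list \<Rightarrow> bool" where
  "has_chord E vs \<longleftrightarrow>
     (\<exists>i<length vs. \<exists>j<length vs.
        i \<noteq> j \<and> j \<noteq> Suc i mod length vs \<and> i \<noteq> Suc j mod length vs \<and> {vs ! i, vs ! j} \<in> E)"

definition chordal :: "'v set set \<Rightarrow> bool" where
  "chordal E \<longleftrightarrow> (\<forall>vs. graph_cycle E vs \<and> length vs \<ge> 4 \<longrightarrow> has_chord E vs)"

definition chordal_cover :: "'v set \<Rightarrow> 'v set set \<Rightarrow> 'v set set \<Rightarrow> bool" where
  "chordal_cover V E E' \<longleftrightarrow> E' \<subseteq> [V]\<^bsup>2\<^esup> \<and> chordal E' \<and> E \<subseteq> E'"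

definition maximal_cliques :: "'v set \<Rightarrow> 'v set set \<Rightarrow> 'v set set" where
  "maximal_cliques V E =
     {C. C \<subseteq> V \<and> clique C E \<and> \<not> (\<exists>D. D \<subseteq> V \<and> clique D E \<and> C \<subset> D)}"

section \<open>Positive semidefinite matrices\<close>

text \<open>\<open>M\<close> is a complex matrix with rows and columns indexed by the finite set \<open>I\<close>.\<close>

definition hermitian_psd_on :: "'i set \<Rightarrow> ('i \<Rightarrow> 'i \<Rightarrow> complex) \<Rightarrow> bool" where
  "hermitian_psd_on I M \<longleftrightarrow>
     (\<forall>i\<in>I. \<forall>j\<in>I. M j i = cnj (M i j)) \<and>
     (\<forall>v. 0 \<le> Re (\<Sum>i\<in>I. \<Sum>j\<in>I. cnj (v i) * M i j * v j))"

end

theory Submission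
  imports Defs
begin

text \<open>The nontrivial inclusion: translating by \<open>c C\<close> moves each clique of \<open>\<Gamma>\<close> into \<open>T\<close> without
  changing the quotients \<open>\<psi>\<^sup>-\<^sup>1\<xi>\<close>, so the partial matrix \<open>y (\<psi>\<^sup>-\<^sup>1\<xi>)\<close>, specified on \<open>\<Gamma>\<close> and the
  diagonal, is positive semidefinite on every clique of \<open>\<Gamma>\<close>. Since \<open>\<Gamma>\<close> is chordal it has a
  positive semidefinite completion on the whole dual group. Averaging the completion over
  translations keeps the entries indexed by \<open>S\<close> and gives a positive definite function, whose
  Fourier transform is the required probability measure.

  The completion is built by splitting a chordal graph along clique separators and gluing the
  completions of the two parts one vertex at a time.\<close>

section \<open>Hermitian positive semidefinite matrices\<close>

definition herm_form :: "'i set \<Rightarrow> ('i \<Rightarrow> 'i \<Rightarrow> complex) \<Rightarrow> ('i \<Rightarrow> complex) \<Rightarrow> complex" where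
  "herm_form I M v = (\<Sum>i\<in>I. \<Sum>j\<in>I. cnj (v i) * M i j * v j)"

lemma hermitian_psd_on_iff_herm_form:
  "hermitian_psd_on I M \<longleftrightarrow>
     (\<forall>i\<in>I. \<forall>j\<in>I. M j i = cnj (M i j)) \<and> (\<forall>v. 0 \<le> Re (herm_form I M v))"
  by (simp add: hermitian_psd_on_def herm_form_def)

lemma hermitian_psd_onD:
  assumes "hermitian_psd_on I M"
  shows "\<And>i j. i \<in> I \<Longrightarrow> j \<in> I \<Longrightarrow> M j i = cnj (M i j)" "\<And>v. 0 \<le> Re (herm_form I M v)"
  using assms unfolding hermitian_psd_on_iff_herm_form by blast+

lemma hermitian_psd_on_cong:
  assumes "\<And>i j. i \<in> I \<Longrightarrow> j \<in> I \<Longrightarrow> M i j = M' i j"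
  shows "hermitian_psd_on I M \<longleftrightarrow> hermitian_psd_on I M'"
  using assms by (simp add: hermitian_psd_on_def cong: sum.cong)

text \<open>A vector on \<open>J\<close> is pushed forward along the injective \<open>f\<close> and
  padded with zeros, which keeps the value of the form. With the identity this restricts to
  principal submatrices; with a translation it moves a clique into \<open>T\<close>.\<close>

lemma hermitian_psd_on_reindex:
  assumes "hermitian_psd_on I M" "inj_on f J" "f ` J \<subseteq> I" "finite I"
  shows "hermitian_psd_on J (\<lambda>i j. M (f i) (f j))"
proof -
  have "0 \<le> Re (herm_form J (\<lambda>i j. M (f i) (f j)) v)" for v
  proof -
    define w where "w = (\<lambda>k. if k \<in> f ` J then v (inv_into J f k) else 0)"
    have w: "w (f i) = v i" if "i \<in> J" for i
      using that assms(2) by (simp add: w_def)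
    have "herm_form I M w = (\<Sum>i\<in>f ` J. \<Sum>j\<in>I. cnj (w i) * M i j * w j)"
      unfolding herm_form_def using assms(3,4)
      by (intro sum.mono_neutral_right) (auto simp: w_def)
    also have "\<dots> = (\<Sum>i\<in>f ` J. \<Sum>j\<in>f ` J. cnj (w i) * M i j * w j)"
      using assms(3,4) by (intro sum.cong sum.mono_neutral_right) (auto simp: w_def)
    also have "\<dots> = herm_form J (\<lambda>i j. M (f i) (f j)) v"
      unfolding herm_form_def
      by (subst sum.reindex[OF assms(2)], intro sum.cong refl, simp,
          subst sum.reindex[OF assms(2)], intro sum.cong refl, simp add: w)
    finally show ?thesis
      using hermitian_psd_onD(2)[OF assms(1), of w] by simp
  qed
  moreover have "M (f j) (f i) = cnj (M (f i) (f j))" if "i \<in> J" "j \<in> J" for i j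
    using hermitian_psd_onD(1)[OF assms(1)] assms(3) that by blast
  ultimately show ?thesis
    unfolding hermitian_psd_on_iff_herm_form by blast
qed

lemma hermitian_psd_on_subset:
  assumes "hermitian_psd_on I M" "J \<subseteq> I" "finite I"
  shows "hermitian_psd_on J M"
  using hermitian_psd_on_reindex[OF assms(1), of "\<lambda>i. i" J] assms by simp

lemma herm_form_insert:
  assumes "finite I" "a \<notin> I"
  shows "herm_form (insert a I) M v =
    herm_form I M v + (\<Sum>i\<in>I. cnj (v i) * M i a) * v a +
    cnj (v a) * (\<Sum>j\<in>I. M a j * v j) + cnj (v a) * M a a * v a"
  using assms
  by (simp add: herm_form_def sum.distrib sum_distrib_left sum_distrib_right algebra_simps)

lemma sum_cnj_row:
  assumes "\<And>i. i \<in> I \<Longrightarrow> M a i = cnj (M i a)"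
  shows "(\<Sum>i\<in>I. cnj (v i) * M i a) = cnj (\<Sum>j\<in>I. M a j * v j)"
  using assms by (simp add: mult.commute)

text \<open>Conjugation only swaps the two summation indices. Since \<open>hermitian_psd_on\<close>
  constrains just the real part, this is what later allows the point masses to be defined through
  \<open>Re\<close>.\<close>

lemma Im_herm_form:
  assumes "hermitian_psd_on I M"
  shows "Im (herm_form I M v) = 0"
proof -
  have "cnj (herm_form I M v) = (\<Sum>i\<in>I. \<Sum>j\<in>I. cnj (v j) * M j i * v i)"
    unfolding herm_form_def cnj_sum
    using hermitian_psd_onD(1)[OF assms, symmetric] by (intro sum.cong refl) (simp add: mult_ac)
  also have "\<dots> = herm_form I M v"
    unfolding herm_form_def by (rule sum.swap)
  finally show ?thesis
    by (simp add: complex_eq_iff)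
qed

section \<open>Zero diagonal entries and Schur complements\<close>

text \<open>On the coordinates \<open>i\<close> and \<open>n\<close> the form has no quadratic term
  at \<open>n\<close>, so a nonzero off-diagonal entry would let it become negative.\<close>

lemma hermitian_psd_on_zero_diag:
  assumes psd: "hermitian_psd_on I M" and "finite I" "i \<in> I" "n \<in> I" and zero: "M n n = 0"
  shows "M i n = 0"
proof (cases "i = n")
  case False
  have psd2: "hermitian_psd_on {i, n} M"
    using assms by (intro hermitian_psd_on_subset[OF psd]) auto
  show ?thesis
  proof (rule ccontr)
    assume nz: "M i n \<noteq> 0"
    \<comment> \<open>This \<open>t\<close> is chosen so that the form takes the value -1.\<close>
    define t where "t = (Re (M i i) + 1) / (2 * (cmod (M i n))\<^sup>2)"
    define v where "v = (\<lambda>k. if k = n then - of_real t * cnj (M i n) else 1)"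
    have "herm_form {i, n} M v = M i i - 2 * of_real t * (M i n * cnj (M i n))"
      using False zero hermitian_psd_onD(1)[OF psd2, of i n]
      by (simp add: herm_form_def v_def algebra_simps)
    also have "M i n * cnj (M i n) = of_real ((cmod (M i n))\<^sup>2)"
      by (rule complex_norm_square[symmetric])
    finally have "Re (herm_form {i, n} M v) = Re (M i i) - 2 * t * (cmod (M i n))\<^sup>2"
      by simp
    also have "2 * t * (cmod (M i n))\<^sup>2 = Re (M i i) + 1"
      using nz by (simp add: t_def)
    finally show False
      using hermitian_psd_onD(2)[OF psd2, of v] by simp
  qed
qed (use zero in simp)

text \<open>Eliminating the coordinate \<open>n\<close> by completing the square: the Schur
  complement at \<open>v\<close> has the value of the form of \<open>M\<close> at a suitable
  extension of \<open>v\<close> to \<open>n\<close>.\<close>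

lemma hermitian_psd_on_Schur_complement:
  assumes "finite I" "n \<notin> I" and psd: "hermitian_psd_on (insert n I) M" and nz: "M n n \<noteq> 0"
  shows "hermitian_psd_on I (\<lambda>i j. M i j - M i n * M n j / M n n)"
proof -
  note herm = hermitian_psd_onD(1)[OF psd]
  have "0 \<le> Re (herm_form I (\<lambda>i j. M i j - M i n * M n j / M n n) v)" for v
  proof -
    define r where "r = (\<Sum>j\<in>I. M n j * v j)"
    have r: "(\<Sum>i\<in>I. cnj (v i) * M i n) = cnj r"
      unfolding r_def by (rule sum_cnj_row, rule herm) auto
    \<comment> \<open>The new coordinate at \<open>n\<close> is the one that minimises the form with
      the other coordinates fixed.\<close>
    define w where "w = v(n := - r / M n n)"
    have [simp]: "(\<Sum>j\<in>I. M n j * w j) = r" "(\<Sum>i\<in>I. cnj (w i) * M i n) = cnj r"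
        "herm_form I M w = herm_form I M v" "w n = - r / M n n"
      using assms(2) unfolding r[symmetric] unfolding r_def w_def herm_form_def
      by (auto intro!: sum.cong)
    have [simp]: "cnj (M n n) = M n n"
      using herm[of n n] by simp
    have "herm_form (insert n I) M w = herm_form I M v - cnj r * r / M n n"
      using assms(1,2) nz by (simp add: herm_form_insert)
    also have "cnj r * r / M n n = (\<Sum>i\<in>I. \<Sum>j\<in>I. cnj (v i) * (M i n * M n j / M n n) * v j)"
      unfolding r[symmetric] unfolding r_def sum_product sum_divide_distrib by (simp add: mult_ac)
    also have "herm_form I M v - \<dots> = herm_form I (\<lambda>i j. M i j - M i n * M n j / M n n) v"
      unfolding herm_form_def sum_subtractf[symmetric] by (simp add: algebra_simps)
    finally show ?thesis
      using hermitian_psd_onD(2)[OF psd, of w] by simp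
  qed
  moreover have "M j i - M j n * M n i / M n n = cnj (M i j - M i n * M n j / M n n)"
    if "i \<in> I" "j \<in> I" for i j
    using that herm[of i j] herm[of n j] herm[of n i] herm[of n n] by (simp add: mult.commute)
  ultimately show ?thesis
    unfolding hermitian_psd_on_iff_herm_form by blast
qed

section \<open>Extension by one vertex and gluing\<close>

text \<open>Gaussian elimination with pivot \<open>n\<close>, using that Schur complements stay
  positive semidefinite. It takes the place of inverting the block of \<open>B\<close> on
  \<open>N\<close>, which may be singular.\<close>

lemma hermitian_psd_on_column_in_range:
  assumes "finite N" "v \<notin> N" "hermitian_psd_on (insert v N) B"
  shows "\<exists>w. \<forall>n\<in>N. (\<Sum>m\<in>N. B n m * w m) = B n v"
  using assms
proof (induction N arbitrary: B rule: finite_induct)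
  case (insert n N)
  have fin: "finite (insert v (insert n N))"
    using insert.hyps by simp
  have n: "n \<notin> insert v N"
    using insert by auto
  show ?case
  proof (cases "B n n = 0")
    \<comment> \<open>A zero pivot kills its whole row and column, so equation \<open>n\<close>
      reads 0 = 0 and the value of \<open>w\<close> at \<open>n\<close> does not affect the
      others.\<close>
    case True
    have col: "B i n = 0" if "i \<in> insert v (insert n N)" for i
      using hermitian_psd_on_zero_diag[of "insert v (insert n N)" B i n] insert.prems(2) that fin True
      by blast
    have row: "B n i = 0" if "i \<in> insert v (insert n N)" for i
      using hermitian_psd_onD(1)[OF insert.prems(2), of i n] col[OF that] that by simp
    have "hermitian_psd_on (insert v N) B"
      using fin by (intro hermitian_psd_on_subset[OF insert.prems(2)]) auto
    then obtain w where w: "\<forall>n\<in>N. (\<Sum>m\<in>N. B n m * w m) = B n v"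
      using insert.IH insert.prems by auto
    show ?thesis
      using w insert.hyps by (intro exI[of _ w]) (auto simp: col row)
  next
    case False
    have "hermitian_psd_on (insert v N) (\<lambda>i j. B i j - B i n * B n j / B n n)"
      using insert False n
      by (intro hermitian_psd_on_Schur_complement) (auto simp: insert_commute)
    then obtain w where w: "\<forall>i\<in>N. (\<Sum>m\<in>N. (B i m - B i n * B n m / B n n) * w m)
        = B i v - B i n * B n v / B n n"
      using insert.IH[of "\<lambda>i j. B i j - B i n * B n j / B n n"] insert.prems by auto
    define s where "s = (\<Sum>m\<in>N. B n m * w m)"
    \<comment> \<open>Back-substitution: the entry at \<open>n\<close> is forced by equation
      \<open>n\<close>.\<close>
    define u where "u = w(n := (B n v - s) / B n n)"
    have u: "(\<Sum>m\<in>insert n N. B i m * u m) = B i n * (B n v - s) / B n n + (\<Sum>m\<in>N. B i m * w m)" for i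
      using insert.hyps by (auto simp: u_def intro!: sum.cong)
    have "(\<Sum>m\<in>insert n N. B i m * u m) = B i v" if "i \<in> N" for i
    proof -
      have "B i n * s / B n n = (\<Sum>m\<in>N. B i n * B n m / B n n * w m)"
        by (simp add: s_def sum_distrib_left sum_divide_distrib mult_ac)
      then have "(\<Sum>m\<in>N. B i m * w m) - B i n * s / B n n = B i v - B i n * B n v / B n n"
        using w that by (simp add: left_diff_distrib sum_subtractf)
      then show ?thesis
        unfolding u by (simp add: right_diff_distrib diff_divide_distrib) (simp add: algebra_simps)
    qed
    moreover have "(\<Sum>m\<in>insert n N. B n m * u m) = B n v"
      unfolding u using False by (simp add: s_def)
    ultimately show ?thesis
      by blast
  qed
qed simp

text \<open>The new column is the combination of columns of \<open>M\<close> that expresses the column \<open>B\<^sub>N\<^sub>,\<^sub>v\<close>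
  through \<open>B\<^sub>N\<^sub>,\<^sub>N\<close>; completing the square leaves a Schur complement of \<open>B\<close>.\<close>

lemma hermitian_psd_on_extend_vertex:
  assumes "finite W" "N \<subseteq> W" "v \<notin> W" and psdM: "hermitian_psd_on W M"
    and psdB: "hermitian_psd_on (insert v N) B"
    and agree: "\<And>i j. i \<in> N \<Longrightarrow> j \<in> N \<Longrightarrow> M i j = B i j"
  shows "\<exists>M'. hermitian_psd_on (insert v W) M' \<and> (\<forall>i\<in>W. \<forall>j\<in>W. M' i j = M i j) \<and>
    (\<forall>i\<in>insert v N. \<forall>j\<in>insert v N. M' i j = B i j)"
proof -
  note hermM = hermitian_psd_onD(1)[OF psdM] and hermB = hermitian_psd_onD(1)[OF psdB]
  have finN: "finite N" and vN: "v \<notin> N"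
    using assms(1-3) finite_subset by auto
  \<comment> \<open>Any solution serves. Its extension by zero to \<open>W\<close> makes the
    combination \<open>col\<close> of the columns of \<open>M\<close> reproduce the prescribed
    entries on \<open>N\<close>.\<close>
  obtain w0 where w0: "\<forall>n\<in>N. (\<Sum>m\<in>N. B n m * w0 m) = B n v"
    using hermitian_psd_on_column_in_range[OF finN vN psdB] by blast
  define w where "w = (\<lambda>i. if i \<in> N then w0 i else 0)"
  define col where "col = (\<lambda>i. \<Sum>n\<in>W. M i n * w n)"
  have colN: "col i = B i v" if "i \<in> N" for i
  proof -
    have "col i = (\<Sum>n\<in>N. M i n * w n)"
      unfolding col_def using assms(1,2)
      by (intro sum.mono_neutral_right) (auto simp: w_def)
    also have "\<dots> = (\<Sum>n\<in>N. B i n * w0 n)"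
      using that by (intro sum.cong) (auto simp: w_def agree)
    finally show ?thesis
      using w0 that by simp
  qed
  define M' where "M' = (\<lambda>i j. if i = v then if j = v then B v v else cnj (col j)
    else if j = v then col i else M i j)"
  have M': "M' i j = M i j" if "i \<in> W" "j \<in> W" for i j
    using that assms(3) by (auto simp: M'_def)
  have M'_col: "M' i v = col i" "M' v i = cnj (col i)" if "i \<in> W" for i
    using that assms(3) by (auto simp: M'_def)
  have form_w: "herm_form W M w = (\<Sum>i\<in>N. cnj (w0 i) * B i v)"
  proof -
    have "herm_form W M w = (\<Sum>i\<in>W. cnj (w i) * col i)"
      by (simp add: herm_form_def col_def sum_distrib_left mult_ac)
    also have "\<dots> = (\<Sum>i\<in>N. cnj (w i) * col i)"
      using assms(1,2) by (intro sum.mono_neutral_right) (auto simp: w_def)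
    finally show ?thesis
      by (simp add: colN w_def)
  qed
  have schur: "0 \<le> Re (B v v - herm_form W M w)"
  proof -
    \<comment> \<open>At \<open>w0\<close> with coordinate -1 at \<open>v\<close>, the form of
      \<open>B\<close> is the Schur complement of its block on \<open>N\<close>, up to a conjugation
      that the real part ignores.\<close>
    define u where "u = w0(v := -1)"
    have [simp]: "herm_form N B u = herm_form N B w0" "u v = -1"
        "(\<Sum>i\<in>N. cnj (u i) * B i v) = (\<Sum>i\<in>N. cnj (w0 i) * B i v)"
        "(\<Sum>i\<in>N. B v i * u i) = (\<Sum>i\<in>N. B v i * w0 i)"
      using vN by (auto simp: u_def herm_form_def intro!: sum.cong)
    have row: "(\<Sum>i\<in>N. B v i * w0 i) = cnj (herm_form W M w)"
      unfolding form_w by (subst sum_cnj_row[of N B v w0]) (rule hermB, auto)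
    have "herm_form N B w0 = (\<Sum>i\<in>N. cnj (w0 i) * (\<Sum>j\<in>N. B i j * w0 j))"
      by (simp add: herm_form_def sum_distrib_left mult_ac)
    also have "\<dots> = herm_form W M w"
      using w0 by (simp add: form_w)
    finally have "herm_form (insert v N) B u = B v v - cnj (herm_form W M w)"
      using finN vN by (simp add: herm_form_insert row form_w[symmetric])
    then show ?thesis
      using hermitian_psd_onD(2)[OF psdB, of u] by simp
  qed
  have "0 \<le> Re (herm_form (insert v W) M' x)" for x
  proof -
    define t where "t = x v"
    \<comment> \<open>Completing the square: the form of \<open>M'\<close> at \<open>x\<close> will
      be that of \<open>M\<close> at \<open>z\<close> plus the squared modulus of \<open>t\<close>
      times the Schur complement from \<open>schur\<close>.\<close>
    define z where "z = (\<lambda>i. x i + t * w i)"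
    define p where "p = (\<Sum>i\<in>W. cnj (x i) * col i)"
    have eq1: "herm_form W M' x = herm_form W M x"
      by (simp add: herm_form_def M' cong: sum.cong)
    have eq2: "(\<Sum>i\<in>W. cnj (x i) * M' i v) = p"
      by (simp add: p_def M'_col)
    have eq3: "(\<Sum>i\<in>W. M' v i * x i) = cnj p"
      by (simp add: p_def M'_col mult.commute)
    have "herm_form (insert v W) M' x =
        herm_form W M x + p * t + cnj t * cnj p + cnj t * B v v * t"
      using assms(1,3) by (simp add: herm_form_insert eq1 eq2 eq3 t_def) (simp add: M'_def)
    moreover have "herm_form W M z = herm_form W M x + p * t + cnj t * cnj p + cnj t * t * herm_form W M w"
    proof -
      have p1: "p * t = (\<Sum>i\<in>W. \<Sum>j\<in>W. cnj (x i) * M i j * (t * w j))"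
        by (simp add: p_def col_def sum_distrib_left sum_distrib_right mult_ac)
      have "cnj t * cnj p = (\<Sum>i\<in>W. \<Sum>j\<in>W. cnj (t * w j) * cnj (M i j) * x i)"
        by (simp add: p_def col_def sum_distrib_left sum_distrib_right mult_ac)
      also have "\<dots> = (\<Sum>i\<in>W. \<Sum>j\<in>W. cnj (t * w j) * M j i * x i)"
        using hermM[symmetric] by (intro sum.cong refl) simp
      also have "\<dots> = (\<Sum>i\<in>W. \<Sum>j\<in>W. cnj (t * w i) * M i j * x j)"
        by (rule sum.swap)
      finally have p2: "cnj t * cnj p = \<dots>" .
      have p3: "cnj t * t * herm_form W M w = (\<Sum>i\<in>W. \<Sum>j\<in>W. cnj (t * w i) * M i j * (t * w j))"
        by (simp add: herm_form_def sum_distrib_left mult_ac)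
      show ?thesis
        unfolding p1 p2 p3 unfolding herm_form_def z_def sum.distrib[symmetric]
        by (intro sum.cong refl) (simp add: algebra_simps)
    qed
    ultimately have "herm_form (insert v W) M' x =
        herm_form W M z + cnj t * t * (B v v - herm_form W M w)"
      by (simp add: algebra_simps)
    also have "cnj t * t = of_real ((cmod t)\<^sup>2)"
      by (subst mult.commute) (rule complex_norm_square[symmetric])
    finally show ?thesis
      using hermitian_psd_onD(2)[OF psdM, of z] schur by simp
  qed
  moreover have "M' j i = cnj (M' i j)" if "i \<in> insert v W" "j \<in> insert v W" for i j
    using that hermM[of i j] hermB[of v v] by (auto simp: M'_def)
  ultimately have "hermitian_psd_on (insert v W) M'"
    unfolding hermitian_psd_on_iff_herm_form by blast
  moreover have "M' i j = B i j" if "i \<in> insert v N" "j \<in> insert v N" for i j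
    using that colN agree vN hermB[of j v] by (auto simp: M'_def)
  ultimately show ?thesis
    using M' by blast
qed

text \<open>The vertices of \<open>V\<^sub>2 - V\<^sub>1\<close> are added to
  \<open>V\<^sub>1\<close> one at a time. The invariant records agreement with
  \<open>M\<^sub>2\<close> on the common part and all vertices added so far; this set plays the role
  of \<open>N\<close> in the one-vertex extension.\<close>

lemma hermitian_psd_on_glue:
  assumes fin: "finite V\<^sub>1" "finite V\<^sub>2"
    and psd1: "hermitian_psd_on V\<^sub>1 M\<^sub>1" and psd2: "hermitian_psd_on V\<^sub>2 M\<^sub>2"
    and agree: "\<And>i j. i \<in> V\<^sub>1 \<inter> V\<^sub>2 \<Longrightarrow> j \<in> V\<^sub>1 \<inter> V\<^sub>2 \<Longrightarrow> M\<^sub>1 i j = M\<^sub>2 i j"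
  shows "\<exists>M. hermitian_psd_on (V\<^sub>1 \<union> V\<^sub>2) M \<and> (\<forall>i\<in>V\<^sub>1. \<forall>j\<in>V\<^sub>1. M i j = M\<^sub>1 i j) \<and>
    (\<forall>i\<in>V\<^sub>2. \<forall>j\<in>V\<^sub>2. M i j = M\<^sub>2 i j)"
proof -
  have "\<exists>M. hermitian_psd_on (V\<^sub>1 \<union> K) M \<and> (\<forall>i\<in>V\<^sub>1. \<forall>j\<in>V\<^sub>1. M i j = M\<^sub>1 i j) \<and>
      (\<forall>i\<in>(V\<^sub>1 \<inter> V\<^sub>2) \<union> K. \<forall>j\<in>(V\<^sub>1 \<inter> V\<^sub>2) \<union> K. M i j = M\<^sub>2 i j)"
    if "finite K" "K \<subseteq> V\<^sub>2 - V\<^sub>1" for K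
    using that
  proof (induction K rule: finite_induct)
    case empty
    then show ?case
      using psd1 agree by (intro exI[of _ M\<^sub>1]) auto
  next
    case (insert v K)
    then obtain M where M: "hermitian_psd_on (V\<^sub>1 \<union> K) M"
      "\<forall>i\<in>V\<^sub>1. \<forall>j\<in>V\<^sub>1. M i j = M\<^sub>1 i j"
      "\<forall>i\<in>(V\<^sub>1 \<inter> V\<^sub>2) \<union> K. \<forall>j\<in>(V\<^sub>1 \<inter> V\<^sub>2) \<union> K. M i j = M\<^sub>2 i j"
      by auto
    have psdK: "hermitian_psd_on (insert v ((V\<^sub>1 \<inter> V\<^sub>2) \<union> K)) M\<^sub>2"
      using insert.prems fin by (intro hermitian_psd_on_subset[OF psd2]) auto
    have "\<exists>M'. hermitian_psd_on (insert v (V\<^sub>1 \<union> K)) M' \<and>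
      (\<forall>i\<in>V\<^sub>1 \<union> K. \<forall>j\<in>V\<^sub>1 \<union> K. M' i j = M i j) \<and>
      (\<forall>i\<in>insert v ((V\<^sub>1 \<inter> V\<^sub>2) \<union> K). \<forall>j\<in>insert v ((V\<^sub>1 \<inter> V\<^sub>2) \<union> K). M' i j = M\<^sub>2 i j)"
      using M(3) insert.hyps insert.prems fin
      by (intro hermitian_psd_on_extend_vertex[OF _ _ _ M(1) psdK]) blast+
    then obtain M' where M': "hermitian_psd_on (insert v (V\<^sub>1 \<union> K)) M'"
      "\<forall>i\<in>V\<^sub>1 \<union> K. \<forall>j\<in>V\<^sub>1 \<union> K. M' i j = M i j"
      "\<forall>i\<in>insert v ((V\<^sub>1 \<inter> V\<^sub>2) \<union> K). \<forall>j\<in>insert v ((V\<^sub>1 \<inter> V\<^sub>2) \<union> K). M' i j = M\<^sub>2 i j"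
      by blast
    show ?case
      using M' M(2) by (intro exI[of _ M']) auto
  qed
  from this[of "V\<^sub>2 - V\<^sub>1"] have "\<exists>M. hermitian_psd_on (V\<^sub>1 \<union> (V\<^sub>2 - V\<^sub>1)) M \<and>
      (\<forall>i\<in>V\<^sub>1. \<forall>j\<in>V\<^sub>1. M i j = M\<^sub>1 i j) \<and>
      (\<forall>i\<in>(V\<^sub>1 \<inter> V\<^sub>2) \<union> (V\<^sub>2 - V\<^sub>1). \<forall>j\<in>(V\<^sub>1 \<inter> V\<^sub>2) \<union> (V\<^sub>2 - V\<^sub>1). M i j = M\<^sub>2 i j)"
    using fin by blast
  moreover have "V\<^sub>1 \<union> (V\<^sub>2 - V\<^sub>1) = V\<^sub>1 \<union> V\<^sub>2" "(V\<^sub>1 \<inter> V\<^sub>2) \<union> (V\<^sub>2 - V\<^sub>1) = V\<^sub>2"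
    by auto
  ultimately show ?thesis
    by simp
qed

section \<open>Completion along a chordal graph\<close>

text \<open>Cycles built from two paths are handled more easily as functions on indices. Ordering
  the ends of the chord turns the modular conditions into the exclusion of consecutive indices and
  of the closing pair.\<close>

lemma chordal_cyclic_sequence:
  assumes "chordal E" "N \<ge> 4" "inj_on h {..<N}"
    and edges: "\<And>i. Suc i < N \<Longrightarrow> {h i, h (Suc i)} \<in> E" and last: "{h (N - 1), h 0} \<in> E"
  shows "\<exists>i j. i < j \<and> j < N \<and> j \<noteq> Suc i \<and> \<not> (i = 0 \<and> j = N - 1) \<and> {h i, h j} \<in> E"
proof -
  define vs where "vs = map h [0..<N]"
  have len: "length vs = N" and nth: "\<And>i. i < N \<Longrightarrow> vs ! i = h i"
    by (auto simp: vs_def)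
  have "{vs ! i, vs ! (Suc i mod length vs)} \<in> E" if "i < length vs" for i
  proof (cases "Suc i = N")
    case True
    then show ?thesis using last that by (auto simp: len nth)
  next
    case False
    then show ?thesis using edges[of i] that by (auto simp: len nth)
  qed
  then have "graph_cycle E vs"
    using assms(2,3) by (auto simp: graph_cycle_def len) (simp add: vs_def distinct_map atLeast0LessThan)
  then have "has_chord E vs"
    using assms(1,2) by (auto simp: chordal_def len)
  then obtain i j where ij: "i < N" "j < N" "i \<noteq> j" "j \<noteq> Suc i mod N" "i \<noteq> Suc j mod N" "{h i, h j} \<in> E"
    by (auto simp: has_chord_def len nth)
  have *: ?thesis if "a < b" "b < N" "b \<noteq> Suc a mod N" "a \<noteq> Suc b mod N" "{h a, h b} \<in> E" for a b
  proof -
    have "b \<noteq> Suc a" "\<not> (a = 0 \<and> b = N - 1)"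
      using that by auto
    then show ?thesis
      using that by blast
  qed
  show ?thesis
  proof (cases "i < j")
    case True
    then show ?thesis
      using *[of i j] ij by blast
  next
    case False
    then show ?thesis
      using *[of j i] ij by (simp add: insert_commute)
  qed
qed

text \<open>As a relation, it lets the reflexive transitive closure express connectivity inside
  \<open>W\<close>. The closure also relates every vertex outside \<open>W\<close> to itself, so
  later arguments ask that the starting vertex lie in \<open>W\<close>.\<close>

definition adj_in :: "'v set set \<Rightarrow> 'v set \<Rightarrow> ('v \<times> 'v) set" where
  "adj_in E W = {(u, v). u \<in> W \<and> v \<in> W \<and> {u, v} \<in> E}"

lemma sym_adj_in: "sym (adj_in E W)"
  by (auto simp: adj_in_def sym_def insert_commute)

lemma adj_in_rtrancl_mono: "W \<subseteq> W' \<Longrightarrow> (adj_in E W)\<^sup>* \<subseteq> (adj_in E W')\<^sup>*"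
  by (rule rtrancl_mono) (auto simp: adj_in_def)

lemma adj_in_rtrancl_sym: "(u, v) \<in> (adj_in E W)\<^sup>* \<Longrightarrow> (v, u) \<in> (adj_in E W)\<^sup>*"
  using sym_rtrancl[OF sym_adj_in] by (meson symD)

text \<open>The last clause forbids shortcuts in the forward direction; for the symmetric relations
  \<open>adj_in\<close> this is chordlessness.\<close>

definition induced_path :: "('v \<times> 'v) set \<Rightarrow> 'v \<Rightarrow> 'v \<Rightarrow> nat \<Rightarrow> (nat \<Rightarrow> 'v) \<Rightarrow> bool" where
  "induced_path r x y n f \<longleftrightarrow> f 0 = x \<and> f n = y \<and> (\<forall>i<n. (f i, f (Suc i)) \<in> r) \<and>
     inj_on f {..n} \<and> (\<forall>i j. i < j \<longrightarrow> j \<le> n \<longrightarrow> (f i, f j) \<in> r \<longrightarrow> j = Suc i)"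

lemma induced_pathD:
  assumes "induced_path r x y n f"
  shows "f 0 = x" "f n = y" "\<And>i. i < n \<Longrightarrow> (f i, f (Suc i)) \<in> r" "inj_on f {..n}"
    "\<And>i j. i < j \<Longrightarrow> j \<le> n \<Longrightarrow> (f i, f j) \<in> r \<Longrightarrow> j = Suc i"
  using assms by (simp_all add: induced_path_def)

text \<open>A walk of minimal length is induced, since a repeated vertex or a shortcut would shorten
  it.\<close>

lemma ex_induced_path:
  assumes "(x, y) \<in> r\<^sup>*"
  shows "\<exists>n f. induced_path r x y n f"
proof -
  define n where "n = (LEAST n. (x, y) \<in> r ^^ n)"
  have ex: "\<exists>n. (x, y) \<in> r ^^ n"
    using assms by (simp add: rtrancl_power)
  then have "(x, y) \<in> r ^^ n"
    unfolding n_def by (rule LeastI_ex)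
  then obtain f where f: "f 0 = x" "f n = y" "\<And>i. i < n \<Longrightarrow> (f i, f (Suc i)) \<in> r"
    by (auto simp: relpow_fun_conv)
  have least: "n \<le> m" if "(x, y) \<in> r ^^ m" for m
    unfolding n_def using that by (rule Least_le)
  have seg: "(f i, f (i + k)) \<in> r ^^ k" if "i + k \<le> n" for i k
    using that f(3) by (induction k) auto
  \<comment> \<open>Replacing the segment from \<open>f i\<close> to \<open>f j\<close> by
    \<open>k\<close> steps cannot beat the minimum. Taking \<open>k\<close> = 0 gives injectivity,
    and \<open>k\<close> = 1 excludes shortcuts.\<close>
  have shortcut: "j \<le> i + k" if "i \<le> j" "j \<le> n" "(f i, f j) \<in> r ^^ k" for i j k
  proof -
    have "(x, f i) \<in> r ^^ i" "(f j, y) \<in> r ^^ (n - j)"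
      using seg[of 0 i] seg[of j "n - j"] that f(1,2) by auto
    then have "(x, y) \<in> r ^^ (i + k + (n - j))"
      using that(3) by (auto simp: relpow_add)
    from least[OF this] show ?thesis
      using that by simp
  qed
  have "f i \<noteq> f j" if "i < j" "j \<le> n" for i j
    using shortcut[of i j 0] that by auto
  then have "inj_on f {..n}"
    by (auto simp: inj_on_def) (metis linorder_neqE_nat)
  moreover have "j = Suc i" if "i < j" "j \<le> n" "(f i, f j) \<in> r" for i j
    using shortcut[of i j 1] that by auto
  ultimately have "induced_path r x y n f"
    using f by (simp add: induced_path_def)
  then show ?thesis by blast
qed

text \<open>Shortest paths from \<open>x\<close> to \<open>y\<close> through \<open>A\<close> and back through \<open>B\<close> would form a chordless
  cycle if \<open>x\<close> and \<open>y\<close> were not adjacent.\<close>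

lemma chordal_two_paths_adjacent:
  assumes "chordal E" and "x \<noteq> y" and disj: "A \<inter> B = {}" "x \<notin> A \<union> B" "y \<notin> A \<union> B"
    and noedge: "\<And>a b. a \<in> A \<Longrightarrow> b \<in> B \<Longrightarrow> {a, b} \<notin> E"
    and pathA: "(x, y) \<in> (adj_in E (insert x (insert y A)))\<^sup>*"
    and pathB: "(y, x) \<in> (adj_in E (insert x (insert y B)))\<^sup>*"
  shows "{x, y} \<in> E"
proof (rule ccontr)
  assume nonadj: "{x, y} \<notin> E"
  obtain n f where "induced_path (adj_in E (insert x (insert y A))) x y n f"
    using ex_induced_path[OF pathA] by blast
  note f = induced_pathD[OF this]
  obtain m g where "induced_path (adj_in E (insert x (insert y B))) y x m g"
    using ex_induced_path[OF pathB] by blast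
  note g = induced_pathD[OF this]
  have n: "n \<ge> 2"
  proof (rule ccontr)
    assume "\<not> n \<ge> 2"
    then have "n = 0 \<or> n = 1" by auto
    then show False
      using f(1,2) f(3)[of 0] \<open>x \<noteq> y\<close> nonadj by (auto simp: adj_in_def)
  qed
  have m: "m \<ge> 2"
  proof (rule ccontr)
    assume "\<not> m \<ge> 2"
    then have "m = 0 \<or> m = 1" by auto
    then show False
      using g(1,2) g(3)[of 0] \<open>x \<noteq> y\<close> nonadj by (auto simp: adj_in_def insert_commute)
  qed
  have fmem: "f i \<in> insert x (insert y A)" if "i \<le> n" for i
    using f(3)[of i] that f(2) by (cases "i = n") (auto simp: adj_in_def)
  have gmem: "g i \<in> insert x (insert y B)" if "i \<le> m" for i
    using g(3)[of i] that g(2) by (cases "i = m") (auto simp: adj_in_def)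
  have fA: "f i \<in> A" if "0 < i" "i < n" for i
  proof -
    have "f i \<noteq> f 0" "f i \<noteq> f n"
      using that inj_onD[OF f(4), of i 0] inj_onD[OF f(4), of i n] by auto
    then show ?thesis
      using fmem[of i] that f(1,2) by auto
  qed
  have gB: "g i \<in> B" if "0 < i" "i < m" for i
  proof -
    have "g i \<noteq> g 0" "g i \<noteq> g m"
      using that inj_onD[OF g(4), of i 0] inj_onD[OF g(4), of i m] by auto
    then show ?thesis
      using gmem[of i] that g(1,2) by auto
  qed
  \<comment> \<open>Both paths are concatenated at \<open>y\<close>, which has index
    \<open>n\<close>. Index \<open>n + m\<close> would be \<open>x\<close> again, so the cycle has
    exactly \<open>n + m\<close> vertices.\<close>
  define h where "h = (\<lambda>i. if i \<le> n then f i else g (i - n))"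
  have hf: "h i = f i" if "i \<le> n" for i
    using that by (simp add: h_def)
  have hg: "h i = g (i - n)" if "i \<ge> n" for i
    using that f(2) g(1) by (auto simp: h_def)
  have inj: "h i \<noteq> h j" if "i < j" "j < n + m" for i j
  proof (cases "j \<le> n")
    case True
    then show ?thesis
      using that inj_onD[OF f(4), of i j] by (auto simp: hf)
  next
    case False
    then have "h j \<in> B"
      using gB[of "j - n"] that by (auto simp: hg)
    moreover have "h i \<notin> B" if "i \<le> n"
      using fmem[of i] that disj by (auto simp: hf)
    moreover have "h i \<noteq> h j" if "i \<ge> n"
    proof -
      have "i - n \<noteq> j - n" "i - n \<le> m" "j - n \<le> m"
        using that \<open>i < j\<close> \<open>j < n + m\<close> by linarith+
      then show ?thesis
        using that inj_onD[OF g(4), of "i - n" "j - n"] \<open>i < j\<close> by (auto simp: hg)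
    qed
    ultimately show ?thesis
      by (cases "i \<le> n") auto
  qed
  have "\<exists>i j. i < j \<and> j < n + m \<and> j \<noteq> Suc i \<and> \<not> (i = 0 \<and> j = n + m - 1) \<and> {h i, h j} \<in> E"
  proof (rule chordal_cyclic_sequence[OF assms(1)])
    show "inj_on h {..<n + m}"
      using inj by (auto simp: inj_on_def) (metis linorder_neqE_nat)
    show "{h i, h (Suc i)} \<in> E" if "Suc i < n + m" for i
      using f(3)[of i] g(3)[of "i - n"] that
      by (cases "i < n") (auto simp: hf hg adj_in_def Suc_diff_le)
    show "{h (n + m - 1), h 0} \<in> E"
      using g(3)[of "m - 1"] m g(2) f(1) by (auto simp: hf hg adj_in_def)
  qed (use n m in simp)
  then obtain i j where ij: "i < j" "j < n + m" "j \<noteq> Suc i" "\<not> (i = 0 \<and> j = n + m - 1)"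
      "{h i, h j} \<in> E"
    by blast
  \<comment> \<open>A chord lies within one of the induced paths or joins the interior of
    \<open>A\<close> to that of \<open>B\<close>. A chord from index 0 into the second path is read
    as one ending at \<open>g m\<close>, which is also \<open>x\<close>.\<close>
  consider "j \<le> n" | "n \<le> i" | "i = 0" "n < j" | "0 < i" "i < n" "n < j"
    using ij by linarith
  then show False
  proof cases
    case 1
    then have "(f i, f j) \<in> adj_in E (insert x (insert y A))"
      using ij fmem[of i] fmem[of j] by (simp add: adj_in_def hf)
    then show False
      using f(5)[of i j] 1 ij by simp
  next
    case 2
    then have "(g (i - n), g (j - n)) \<in> adj_in E (insert x (insert y B))"
      using ij gmem[of "i - n"] gmem[of "j - n"] by (simp add: adj_in_def hg)
    moreover have "i - n < j - n" "j - n \<le> m" "j - n \<noteq> Suc (i - n)"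
      using 2 ij by linarith+
    ultimately show False
      using g(5)[of "i - n" "j - n"] by blast
  next
    case 3
    then have "(g (j - n), g m) \<in> adj_in E (insert x (insert y B))"
      using ij gmem[of "j - n"] gmem[of m] f(1) g(2) by (simp add: adj_in_def hf hg insert_commute)
    moreover have "j - n < m" "m \<noteq> Suc (j - n)"
      using 3 ij by linarith+
    ultimately show False
      using g(5)[of "j - n" m] by blast
  next
    case 4
    then show False
      using noedge[of "h i" "h j"] fA[of i] gB[of "j - n"] ij by (simp add: hf hg)
  qed
qed

section \<open>Components and clique separators\<close>

text \<open>All vertices along a walk from \<open>a\<close> are themselves reachable from
  \<open>a\<close>, so the walk stays in the component.\<close>

lemma component_connected:
  assumes "(a, u) \<in> (adj_in E W)\<^sup>*"
  shows "(a, u) \<in> (adj_in E {v. (a, v) \<in> (adj_in E W)\<^sup>*})\<^sup>*"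
  using assms
proof (induction rule: rtrancl_induct)
  case (step u v)
  then have "(u, v) \<in> adj_in E {v. (a, v) \<in> (adj_in E W)\<^sup>*}"
    by (auto simp: adj_in_def intro: rtrancl_into_rtrancl)
  then show ?case
    using step.IH by (rule rtrancl_into_rtrancl[rotated])
qed simp

text \<open>If no vertex of the component of \<open>a\<close> were adjacent to \<open>x\<close>, a
  walk from \<open>a\<close> could never enter \<open>x\<close> and would remain in
  \<open>W\<close>.\<close>

lemma component_neighbour:
  assumes "(a, b) \<in> (adj_in E (insert x W))\<^sup>*" "(a, b) \<notin> (adj_in E W)\<^sup>*" "a \<in> W" "b \<noteq> x"
  shows "\<exists>u. (a, u) \<in> (adj_in E W)\<^sup>* \<and> {u, x} \<in> E"
proof (rule ccontr)
  assume none: "\<not> ?thesis"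
  have "(a, b) \<in> (adj_in E W)\<^sup>*"
    using assms(1)
  proof (induction rule: rtrancl_induct)
    case (step u v)
    have "u \<in> W"
      using step.IH assms(3) by (cases rule: rtranclE) (auto simp: adj_in_def)
    moreover have "v \<noteq> x"
      using none step by (auto simp: adj_in_def)
    ultimately have "(u, v) \<in> adj_in E W"
      using step.hyps by (auto simp: adj_in_def)
    then show ?case
      using step.IH by (rule rtrancl_into_rtrancl[rotated])
  qed simp
  with assms(2) show False ..
qed

text \<open>Step from \<open>x\<close> into the component, cross it, and leave to \<open>y\<close>.
  This supplies both paths required by \<open>chordal_two_paths_adjacent\<close>.\<close>

lemma component_path:
  assumes "(a, u) \<in> (adj_in E W)\<^sup>*" "(a, u') \<in> (adj_in E W)\<^sup>*" "{u, x} \<in> E" "{u', y} \<in> E"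
  shows "(x, y) \<in> (adj_in E (insert x (insert y {v. (a, v) \<in> (adj_in E W)\<^sup>*})))\<^sup>*"
proof -
  let ?A = "{v. (a, v) \<in> (adj_in E W)\<^sup>*}"
  have "(x, u) \<in> adj_in E (insert x (insert y ?A))" "(u', y) \<in> adj_in E (insert x (insert y ?A))"
    using assms by (auto simp: adj_in_def insert_commute)
  moreover have "(u, u') \<in> (adj_in E ?A)\<^sup>*"
    using adj_in_rtrancl_sym[OF component_connected[OF assms(1)]] component_connected[OF assms(2)]
    by (rule rtrancl_trans)
  then have "(u, u') \<in> (adj_in E (insert x (insert y ?A)))\<^sup>*"
    using adj_in_rtrancl_mono[of ?A "insert x (insert y ?A)" E] by blast
  ultimately show ?thesis
    by (meson converse_rtrancl_into_rtrancl rtrancl_into_rtrancl)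
qed

text \<open>Dirac's argument: an inclusion-minimal set separating two nonadjacent vertices of a
  chordal graph is a clique, because any two of its vertices are linked through the components on
  both sides.\<close>

lemma chordal_clique_separator:
  assumes "finite V" "chordal E" "\<not> clique V E"
  obtains V\<^sub>1 V\<^sub>2 where "V\<^sub>1 \<subset> V" "V\<^sub>2 \<subset> V" "V\<^sub>1 \<union> V\<^sub>2 = V" "clique (V\<^sub>1 \<inter> V\<^sub>2) E"
    "\<And>u v. u \<in> V\<^sub>1 - V\<^sub>2 \<Longrightarrow> v \<in> V\<^sub>2 - V\<^sub>1 \<Longrightarrow> {u, v} \<notin> E"
proof -
  obtain a b where ab: "a \<in> V" "b \<in> V" "a \<noteq> b" "{a, b} \<notin> E"
    using assms(3) by (auto simp: clique_def)
  define sep where "sep = (\<lambda>X. X \<subseteq> V - {a, b} \<and> (a, b) \<notin> (adj_in E (V - X))\<^sup>*)"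
  \<comment> \<open>Separators exist: with all other vertices removed, the nonadjacent
    \<open>a\<close> and \<open>b\<close> are disconnected.\<close>
  have "sep (V - {a, b})"
  proof -
    have "v = a" if "(a, v) \<in> (adj_in E (V - (V - {a, b})))\<^sup>*" for v
      using that
    proof (induction rule: rtrancl_induct)
      case (step u v)
      then show ?case
        using ab by (auto simp: adj_in_def)
    qed simp
    then show ?thesis
      using ab by (auto simp: sep_def)
  qed
  moreover have "finite (Collect sep)"
    by (rule finite_subset[of _ "Pow V"]) (use assms(1) in \<open>unfold sep_def, blast, simp\<close>)
  ultimately obtain X where X: "sep X" and min: "\<And>Y. sep Y \<Longrightarrow> Y \<subseteq> X \<Longrightarrow> Y = X"
    using finite_has_minimal[of "Collect sep"] by blast
  define A where "A = {v. (a, v) \<in> (adj_in E (V - X))\<^sup>*}"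
  define B where "B = {v. (b, v) \<in> (adj_in E (V - X))\<^sup>*}"
  have aW: "a \<in> V - X" and bW: "b \<in> V - X" and XV: "X \<subseteq> V" and nab: "(a, b) \<notin> (adj_in E (V - X))\<^sup>*"
    using X ab by (auto simp: sep_def)
  have comp_sub: "v \<in> V - X" if "(c, v) \<in> (adj_in E (V - X))\<^sup>*" "c \<in> V - X" for c v
    using that by (cases rule: rtranclE) (auto simp: adj_in_def)
  have A: "A \<subseteq> V - X" "a \<in> A" "b \<notin> A"
    using comp_sub aW nab by (auto simp: A_def)
  have B: "B \<subseteq> V - X"
    using comp_sub bW by (auto simp: B_def)
  have disj: "A \<inter> B = {}"
    using nab rtrancl_trans[OF _ adj_in_rtrancl_sym, of a _ E "V - X" b] by (auto simp: A_def B_def)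
  have noedge: "{u, v} \<notin> E" if "u \<in> A" "v \<in> V - X - A" for u v
  proof
    assume "{u, v} \<in> E"
    then have "(u, v) \<in> adj_in E (V - X)"
      using that A by (auto simp: adj_in_def)
    then have "v \<in> A"
      using that(1) unfolding A_def by (auto intro: rtrancl_into_rtrancl)
    with that show False by blast
  qed
  \<comment> \<open>By minimality, returning \<open>x\<close> to the graph reconnects
    \<open>a\<close> and \<open>b\<close>, so both components have a neighbour of
    \<open>x\<close>.\<close>
  have nbr: "(\<exists>u. (a, u) \<in> (adj_in E (V - X))\<^sup>* \<and> {u, x} \<in> E) \<and>
      (\<exists>u. (b, u) \<in> (adj_in E (V - X))\<^sup>* \<and> {u, x} \<in> E)" if "x \<in> X" for x
  proof -
    have "\<not> sep (X - {x})"
      using min[of "X - {x}"] that by blast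
    moreover have "V - (X - {x}) = insert x (V - X)"
      using that XV by auto
    ultimately have path: "(a, b) \<in> (adj_in E (insert x (V - X)))\<^sup>*"
      using X by (auto simp: sep_def)
    have "a \<noteq> x" "b \<noteq> x"
      using that aW bW by auto
    moreover have "(b, a) \<notin> (adj_in E (V - X))\<^sup>*"
      using nab adj_in_rtrancl_sym[of b a] by blast
    ultimately show ?thesis
      using component_neighbour[OF path nab aW]
        component_neighbour[OF adj_in_rtrancl_sym[OF path] _ bW] by blast
  qed
  have cl: "clique X E"
    unfolding clique_def
  proof (intro ballI impI)
    fix x y assume xy: "x \<in> X" "y \<in> X" "x \<noteq> y"
    obtain u\<^sub>1 u\<^sub>2 w\<^sub>1 w\<^sub>2 where
      u: "(a, u\<^sub>1) \<in> (adj_in E (V - X))\<^sup>*" "(a, u\<^sub>2) \<in> (adj_in E (V - X))\<^sup>*"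
        "{u\<^sub>1, x} \<in> E" "{u\<^sub>2, y} \<in> E" and
      w: "(b, w\<^sub>2) \<in> (adj_in E (V - X))\<^sup>*" "(b, w\<^sub>1) \<in> (adj_in E (V - X))\<^sup>*"
        "{w\<^sub>2, y} \<in> E" "{w\<^sub>1, x} \<in> E"
      using nbr[OF xy(1)] nbr[OF xy(2)] by blast
    have pA: "(x, y) \<in> (adj_in E (insert x (insert y A)))\<^sup>*"
      using component_path[OF u] by (simp add: A_def)
    have pB: "(y, x) \<in> (adj_in E (insert x (insert y B)))\<^sup>*"
      using component_path[OF w] by (simp add: B_def insert_commute)
    show "{x, y} \<in> E"
    proof (rule chordal_two_paths_adjacent[OF assms(2) xy(3) disj _ _ _ pA pB])
      show "{u, v} \<notin> E" if "u \<in> A" "v \<in> B" for u v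
        using noedge[of u v] that B disj by blast
    qed (use A B xy in auto)
  qed
  \<comment> \<open>The second part keeps \<open>X\<close>, \<open>B\<close> and all remaining
    components. The parts are proper since \<open>b\<close> is missing from the first and
    \<open>a\<close> from the second.\<close>
  show thesis
  proof (rule that[of "A \<union> X" "V - A"])
    have "(A \<union> X) \<inter> (V - A) = X"
      using A XV by auto
    then show "clique ((A \<union> X) \<inter> (V - A)) E"
      using cl by simp
    show "{u, v} \<notin> E" if "u \<in> A \<union> X - (V - A)" "v \<in> V - A - (A \<union> X)" for u v
      using noedge[of u v] that A XV by blast
  qed (use A XV aW bW in auto)
qed

section \<open>Completion of partial matrices\<close>

text \<open>Induction over subsets of the vertex set with the chordal \<open>E\<close> fixed. On a
  clique \<open>M\<close> itself serves; otherwise a clique separator gives two smaller parts whose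
  completions are glued.\<close>

theorem chordal_psd_completion:
  assumes "finite V" "chordal E"
    and "\<And>K. K \<subseteq> V \<Longrightarrow> clique K E \<Longrightarrow> hermitian_psd_on K M"
  shows "\<exists>M'. hermitian_psd_on V M' \<and>
    (\<forall>u\<in>V. \<forall>v\<in>V. u = v \<or> {u, v} \<in> E \<longrightarrow> M' u v = M u v)"
  using assms(1,3)
proof (induction V rule: finite_psubset_induct)
  case (psubset V)
  show ?case
  proof (cases "clique V E")
    case True
    then show ?thesis
      using psubset.prems by blast
  next
    case False
    then obtain V\<^sub>1 V\<^sub>2 where V: "V\<^sub>1 \<subset> V" "V\<^sub>2 \<subset> V" "V\<^sub>1 \<union> V\<^sub>2 = V" "clique (V\<^sub>1 \<inter> V\<^sub>2) E"
      and noedge: "\<And>u v. u \<in> V\<^sub>1 - V\<^sub>2 \<Longrightarrow> v \<in> V\<^sub>2 - V\<^sub>1 \<Longrightarrow> {u, v} \<notin> E"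
      using chordal_clique_separator[OF psubset.hyps assms(2)] by metis
    obtain M\<^sub>1 where M1: "hermitian_psd_on V\<^sub>1 M\<^sub>1"
      "\<And>u v. u \<in> V\<^sub>1 \<Longrightarrow> v \<in> V\<^sub>1 \<Longrightarrow> u = v \<or> {u, v} \<in> E \<Longrightarrow> M\<^sub>1 u v = M u v"
      using psubset.IH[OF V(1)] psubset.prems V(1) by (metis order_trans psubset_imp_subset)
    obtain M\<^sub>2 where M2: "hermitian_psd_on V\<^sub>2 M\<^sub>2"
      "\<And>u v. u \<in> V\<^sub>2 \<Longrightarrow> v \<in> V\<^sub>2 \<Longrightarrow> u = v \<or> {u, v} \<in> E \<Longrightarrow> M\<^sub>2 u v = M u v"
      using psubset.IH[OF V(2)] psubset.prems V(2) by (metis order_trans psubset_imp_subset)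
    \<comment> \<open>All entries over the separator are prescribed because it is a clique, so both
      completions equal \<open>M\<close> there.\<close>
    have agree: "M\<^sub>1 u v = M\<^sub>2 u v" if "u \<in> V\<^sub>1 \<inter> V\<^sub>2" "v \<in> V\<^sub>1 \<inter> V\<^sub>2" for u v
      using M1(2)[of u v] M2(2)[of u v] V(4) that unfolding clique_def by (metis IntD1 IntD2)
    have "finite V\<^sub>1" "finite V\<^sub>2"
      using V psubset.hyps finite_subset by blast+
    then obtain M' where M': "hermitian_psd_on V M'" "\<forall>i\<in>V\<^sub>1. \<forall>j\<in>V\<^sub>1. M' i j = M\<^sub>1 i j"
        "\<forall>i\<in>V\<^sub>2. \<forall>j\<in>V\<^sub>2. M' i j = M\<^sub>2 i j"
      using hermitian_psd_on_glue[OF _ _ M1(1) M2(1) agree] V(3) by metis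
    have "M' u v = M u v" if "u \<in> V" "v \<in> V" and adj: "u = v \<or> {u, v} \<in> E" for u v
    proof -
      have "(u \<in> V\<^sub>1 \<and> v \<in> V\<^sub>1) \<or> (u \<in> V\<^sub>2 \<and> v \<in> V\<^sub>2)"
        using noedge[of u v] noedge[of v u] that V(3) by (auto simp: insert_commute)
      then show ?thesis
        using M'(2,3) M1(2) M2(2) adj by metis
    qed
    then show ?thesis
      using M'(1) by blast
  qed
qed

section \<open>Characters and positive definite matrices\<close>

text \<open>Translating the summation variable by \<open>g\<close> multiplies the sum by
  \<open>\<phi> g\<close>; if this factor is not 1, the sum vanishes.\<close>

lemma sum_character:
  fixes G (structure)
  assumes "group G" "finite (carrier G)" and \<phi>: "\<phi> \<in> carrier (dual_group G)"
  shows "(\<Sum>x\<in>carrier G. \<phi> x) = (if \<phi> = \<one>\<^bsub>dual_group G\<^esub> then of_nat (order G) else 0)"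
proof (cases "\<phi> = \<one>\<^bsub>dual_group G\<^esub>")
  case True
  then show ?thesis
    by (simp add: one_dual_group order_def)
next
  case False
  interpret group G by fact
  have "\<exists>g\<in>carrier G. \<phi> g \<noteq> 1"
  proof (rule ccontr)
    assume "\<not> ?thesis"
    moreover have "\<phi> \<in> extensional (carrier G)"
      using \<phi> by (simp add: mem_dual_group_iff)
    ultimately have "\<phi> = (\<lambda>x\<in>carrier G. 1)"
      by (intro extensionalityI[of _ "carrier G"]) auto
    with False show False by (simp add: one_dual_group)
  qed
  then obtain g where g: "g \<in> carrier G" "\<phi> g \<noteq> 1" by blast
  have "(\<Sum>x\<in>carrier G. \<phi> x) = (\<Sum>x\<in>(\<lambda>x. g \<otimes> x) ` carrier G. \<phi> x)"
    using g by (simp add: surj_const_mult)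
  also have "\<dots> = (\<Sum>x\<in>carrier G. \<phi> (g \<otimes> x))"
    using g by (simp add: sum.reindex inj_on_cmult)
  also have "\<dots> = \<phi> g * (\<Sum>x\<in>carrier G. \<phi> x)"
    using g \<phi> by (simp add: sum_distrib_left mem_dual_group_iff)
  finally have "(1 - \<phi> g) * (\<Sum>x\<in>carrier G. \<phi> x) = 0"
    by (simp add: algebra_simps)
  then show ?thesis
    using g(2) False by simp
qed

text \<open>The summand is itself a character, trivial exactly when \<open>\<xi>\<close> is the
  product of \<open>\<psi>\<close> and \<open>\<phi>\<close>.\<close>

lemma sum_characters_orthogonal:
  fixes G (structure)
  assumes "group G" "finite (carrier G)"
    and D: "\<psi> \<in> carrier (dual_group G)" "\<xi> \<in> carrier (dual_group G)" "\<phi> \<in> carrier (dual_group G)"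
  shows "(\<Sum>x\<in>carrier G. \<psi> x * cnj (\<xi> x) * \<phi> x) =
    (if \<xi> = \<psi> \<otimes>\<^bsub>dual_group G\<^esub> \<phi> then of_nat (order G) else 0)"
proof -
  interpret D: comm_group "dual_group G" using comm_group_dual_group[OF assms(1)] .
  let ?\<theta> = "inv\<^bsub>dual_group G\<^esub> \<xi> \<otimes>\<^bsub>dual_group G\<^esub> (\<psi> \<otimes>\<^bsub>dual_group G\<^esub> \<phi>)"
  have "(\<Sum>x\<in>carrier G. \<psi> x * cnj (\<xi> x) * \<phi> x) = (\<Sum>x\<in>carrier G. ?\<theta> x)"
    by (rule sum.cong) (simp_all add: mult_dual_group inv_dual_group[OF assms(1,2) D(2)] mult_ac)
  also have "\<dots> = (if ?\<theta> = \<one>\<^bsub>dual_group G\<^esub> then of_nat (order G) else 0)"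
    using D by (intro sum_character[OF assms(1,2)]) simp
  also have "?\<theta> = \<one>\<^bsub>dual_group G\<^esub> \<longleftrightarrow> \<xi> = \<psi> \<otimes>\<^bsub>dual_group G\<^esub> \<phi>"
    using D D.inv_solve_left'[of "\<one>\<^bsub>dual_group G\<^esub>" \<xi> "\<psi> \<otimes>\<^bsub>dual_group G\<^esub> \<phi>"] by auto
  finally show ?thesis .
qed

section \<open>Moments of measures and positive definiteness\<close>

lemma expectation_finite_support:
  fixes f :: "'a \<Rightarrow> complex"
  assumes "finite A" "set_pmf \<mu> \<subseteq> A"
  shows "measure_pmf.expectation \<mu> f = (\<Sum>x\<in>A. of_real (pmf \<mu> x) * f x)"
  using assms by (subst integral_measure_pmf[of A]) (auto simp: scaleR_conv_of_real)

text \<open>The form at \<open>v\<close> is the expectation of the squared modulus of the sum of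
  \<open>\<xi> x * v \<xi>\<close> over \<open>\<xi>\<close> in \<open>I\<close>.\<close>

lemma hermitian_psd_on_expectation:
  fixes G (structure)
  assumes "group G" "finite (carrier G)" "set_pmf \<mu> \<subseteq> carrier G" and I: "I \<subseteq> carrier (dual_group G)"
  shows "hermitian_psd_on I (\<lambda>\<psi> \<xi>.
    measure_pmf.expectation \<mu> (inv\<^bsub>dual_group G\<^esub> \<psi> \<otimes>\<^bsub>dual_group G\<^esub> \<xi>))"
proof -
  have E: "measure_pmf.expectation \<mu> (inv\<^bsub>dual_group G\<^esub> \<psi> \<otimes>\<^bsub>dual_group G\<^esub> \<xi>) =
      (\<Sum>x\<in>carrier G. of_real (pmf \<mu> x) * (cnj (\<psi> x) * \<xi> x))" if "\<psi> \<in> I" for \<psi> \<xi>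
    unfolding expectation_finite_support[OF assms(2,3)]
    using that I by (intro sum.cong refl) (auto simp: mult_dual_group inv_dual_group[OF assms(1,2)])
  have "hermitian_psd_on I (\<lambda>\<psi> \<xi>. \<Sum>x\<in>carrier G. of_real (pmf \<mu> x) * (cnj (\<psi> x) * \<xi> x))"
    unfolding hermitian_psd_on_iff_herm_form
  proof (intro conjI ballI allI)
    fix v :: "('a \<Rightarrow> complex) \<Rightarrow> complex"
    let ?s = "\<lambda>x. \<Sum>\<xi>\<in>I. \<xi> x * v \<xi>"
    have "herm_form I (\<lambda>\<psi> \<xi>. \<Sum>x\<in>carrier G. of_real (pmf \<mu> x) * (cnj (\<psi> x) * \<xi> x)) v =
        (\<Sum>\<psi>\<in>I. \<Sum>\<xi>\<in>I. \<Sum>x\<in>carrier G. of_real (pmf \<mu> x) * (cnj (\<psi> x * v \<psi>) * (\<xi> x * v \<xi>)))"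
      by (simp add: herm_form_def sum_distrib_left sum_distrib_right mult_ac)
    also have "\<dots> = (\<Sum>\<psi>\<in>I. \<Sum>x\<in>carrier G. \<Sum>\<xi>\<in>I.
        of_real (pmf \<mu> x) * (cnj (\<psi> x * v \<psi>) * (\<xi> x * v \<xi>)))"
      by (intro sum.cong refl sum.swap)
    also have "\<dots> = (\<Sum>x\<in>carrier G. \<Sum>\<psi>\<in>I. \<Sum>\<xi>\<in>I.
        of_real (pmf \<mu> x) * (cnj (\<psi> x * v \<psi>) * (\<xi> x * v \<xi>)))"
      by (rule sum.swap)
    also have "\<dots> = (\<Sum>x\<in>carrier G. of_real (pmf \<mu> x) * (cnj (?s x) * ?s x))"
      by (simp only: cnj_sum sum_product) (simp only: sum_distrib_left)
    also have "\<dots> = (\<Sum>x\<in>carrier G. of_real (pmf \<mu> x * (cmod (?s x))\<^sup>2))"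
      by (intro sum.cong refl) (simp only: of_real_mult complex_norm_square mult.commute)
    finally show "0 \<le> Re (herm_form I (\<lambda>\<psi> \<xi>. \<Sum>x\<in>carrier G. of_real (pmf \<mu> x) * (cnj (\<psi> x) * \<xi> x)) v)"
      by (simp add: sum_nonneg del: of_real_mult of_real_power)
  qed (simp add: mult_ac)
  then show ?thesis
    by (subst hermitian_psd_on_cong[OF E]) auto
qed

text \<open>The mass at \<open>x\<close> is, up to a positive factor, the value of the form of \<open>M\<close> at the vector
  \<open>\<psi> \<mapsto> cnj (\<psi> x)\<close>, which is the Fourier transform at \<open>x\<close> of the translation average of \<open>M\<close>.\<close>

lemma psd_on_dual_group_moments:
  fixes G (structure)
  assumes "group G" "finite (carrier G)"
    and psd: "hermitian_psd_on (carrier (dual_group G)) M"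
    and diag: "\<And>\<psi>. \<psi> \<in> carrier (dual_group G) \<Longrightarrow> M \<psi> \<psi> = 1"
  shows "\<exists>\<mu>. set_pmf \<mu> \<subseteq> carrier G \<and> (\<forall>\<phi>\<in>carrier (dual_group G).
    measure_pmf.expectation \<mu> \<phi> =
      (\<Sum>\<psi>\<in>carrier (dual_group G). M \<psi> (\<psi> \<otimes>\<^bsub>dual_group G\<^esub> \<phi>)) / of_nat (card (carrier (dual_group G))))"
proof -
  interpret group G by fact
  interpret D: comm_group "dual_group G" using comm_group_dual_group[OF assms(1)] .
  let ?D = "carrier (dual_group G)"
  have finD: "finite ?D"
    by (rule finite_dual_group[OF assms(1,2)])
  have cardD: "card ?D \<noteq> 0" and ordG: "order G \<noteq> 0"
    using finD D.one_closed assms(2) order_gt_0_iff_finite by auto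
  \<comment> \<open>The factor \<open>order G\<close> offsets the constant from orthogonality, and
    \<open>card ?D\<close> counts the translates being averaged. The value 0 off the carrier makes
    \<open>p\<close> a mass function on the whole type.\<close>
  define p where "p = (\<lambda>x. if x \<in> carrier G
    then Re (herm_form ?D M (\<lambda>\<psi>. cnj (\<psi> x))) / (real (order G) * real (card ?D)) else 0)"
  have p: "of_real (p x) = herm_form ?D M (\<lambda>\<psi>. cnj (\<psi> x)) / (of_nat (order G) * of_nat (card ?D))"
    if "x \<in> carrier G" for x
    using that Im_herm_form[OF psd] by (simp add: p_def complex_eq_iff)
  have p_nonneg: "0 \<le> p x" for x
    using hermitian_psd_onD(2)[OF psd] by (simp add: p_def)
  have moment: "(\<Sum>x\<in>carrier G. of_real (p x) * \<phi> x) =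
      (\<Sum>\<psi>\<in>?D. M \<psi> (\<psi> \<otimes>\<^bsub>dual_group G\<^esub> \<phi>)) / of_nat (card ?D)" if \<phi>: "\<phi> \<in> ?D" for \<phi>
  proof -
    have "(\<Sum>x\<in>carrier G. herm_form ?D M (\<lambda>\<psi>. cnj (\<psi> x)) * \<phi> x) =
        (\<Sum>x\<in>carrier G. \<Sum>\<psi>\<in>?D. \<Sum>\<xi>\<in>?D. M \<psi> \<xi> * (\<psi> x * cnj (\<xi> x) * \<phi> x))"
      by (simp add: herm_form_def sum_distrib_left sum_distrib_right mult_ac)
    also have "\<dots> = (\<Sum>\<psi>\<in>?D. \<Sum>x\<in>carrier G. \<Sum>\<xi>\<in>?D. M \<psi> \<xi> * (\<psi> x * cnj (\<xi> x) * \<phi> x))"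
      by (rule sum.swap)
    also have "\<dots> = (\<Sum>\<psi>\<in>?D. \<Sum>\<xi>\<in>?D. \<Sum>x\<in>carrier G. M \<psi> \<xi> * (\<psi> x * cnj (\<xi> x) * \<phi> x))"
      by (intro sum.cong refl sum.swap)
    also have "\<dots> = (\<Sum>\<psi>\<in>?D. \<Sum>\<xi>\<in>?D. M \<psi> \<xi> *
        (if \<xi> = \<psi> \<otimes>\<^bsub>dual_group G\<^esub> \<phi> then of_nat (order G) else 0))"
      unfolding sum_distrib_left[symmetric]
      by (intro sum.cong refl arg_cong2[where f = "(*)"] sum_characters_orthogonal[OF assms(1,2)] \<phi>)
    also have "\<dots> = (\<Sum>\<psi>\<in>?D. M \<psi> (\<psi> \<otimes>\<^bsub>dual_group G\<^esub> \<phi>) * of_nat (order G))"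
      using \<phi> finD by (intro sum.cong refl) (simp add: if_distrib sum.delta cong: if_cong)
    finally have "(\<Sum>x\<in>carrier G. herm_form ?D M (\<lambda>\<psi>. cnj (\<psi> x)) * \<phi> x) =
        of_nat (order G) * (\<Sum>\<psi>\<in>?D. M \<psi> (\<psi> \<otimes>\<^bsub>dual_group G\<^esub> \<phi>))"
      by (simp add: sum_distrib_left mult.commute)
    moreover have "(\<Sum>x\<in>carrier G. of_real (p x) * \<phi> x) =
        (\<Sum>x\<in>carrier G. herm_form ?D M (\<lambda>\<psi>. cnj (\<psi> x)) * \<phi> x) / (of_nat (order G) * of_nat (card ?D))"
      by (simp add: p sum_divide_distrib)
    ultimately show ?thesis
      using ordG by simp
  qed
  \<comment> \<open>The total mass is the moment of the trivial character, hence the average of the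
    diagonal of \<open>M\<close>.\<close>
  have "of_real (\<Sum>x\<in>carrier G. p x) = (\<Sum>x\<in>carrier G. of_real (p x) * \<one>\<^bsub>dual_group G\<^esub> x)"
    by (simp add: one_dual_group)
  also have "\<dots> = (1 :: complex)"
    using moment[OF D.one_closed] cardD by (simp add: diag)
  finally have total: "(\<Sum>x\<in>carrier G. p x) = 1"
    by (simp only: of_real_eq_1_iff)
  have "(\<integral>\<^sup>+x. ennreal (p x) \<partial>count_space UNIV) = (\<Sum>x\<in>carrier G. ennreal (p x))"
    using assms(2) by (intro nn_integral_count_space') (auto simp: p_def)
  also have "\<dots> = 1"
    using p_nonneg total by (simp add: sum_ennreal)
  finally have pmf: "pmf (embed_pmf p) x = p x" for x
    using p_nonneg by (intro pmf_embed_pmf)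
  then have supp: "set_pmf (embed_pmf p) \<subseteq> carrier G"
    by (auto simp: set_pmf_iff p_def split: if_splits)
  have "measure_pmf.expectation (embed_pmf p) \<phi> =
      (\<Sum>\<psi>\<in>?D. M \<psi> (\<psi> \<otimes>\<^bsub>dual_group G\<^esub> \<phi>)) / of_nat (card ?D)" if "\<phi> \<in> ?D" for \<phi>
    unfolding expectation_finite_support[OF assms(2) supp] pmf by (rule moment[OF that])
  with supp show ?thesis
    by blast
qed

section \<open>The moment polytope\<close>

text \<open>This bridges the definition of \<open>T\<close>, which uses maximal cliques, and the
  completion theorem, which asks about all cliques.\<close>

lemma clique_subset_maximal_clique:
  assumes "finite V" "K \<subseteq> V" "clique K E"
  shows "\<exists>C\<in>maximal_cliques V E. K \<subseteq> C"
proof -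
  let ?A = "{C. C \<subseteq> V \<and> clique C E}"
  have "finite ?A"
    by (rule finite_subset[of _ "Pow V"]) (use assms(1) in auto)
  moreover have "K \<in> ?A"
    using assms(2,3) by simp
  ultimately obtain C where C: "C \<in> ?A" "K \<subseteq> C" and max: "\<forall>D\<in>?A. C \<subseteq> D \<longrightarrow> C = D"
    using finite_has_maximal2[of ?A K] by meson
  then have "C \<in> maximal_cliques V E"
    by (simp add: maximal_cliques_def psubset_eq)
  with C(2) show ?thesis
    by blast
qed

theorem mainTheorem2:
  fixes G :: "('a, 'b) monoid_scheme"
    and S :: "('a \<Rightarrow> complex) set"
    and \<Gamma> :: "('a \<Rightarrow> complex) set set"
    and c :: "('a \<Rightarrow> complex) set \<Rightarrow> ('a \<Rightarrow> complex)"
    and T :: "('a \<Rightarrow> complex) set"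
  assumes "comm_group G" and "finite (carrier G)"
    and "S \<subseteq> carrier (dual_group G)"
    and "\<forall>\<psi>\<in>S. inv\<^bsub>dual_group G\<^esub> \<psi> \<in> S"
    and "chordal_cover (carrier (dual_group G)) (cayley_graph (dual_group G) S) \<Gamma>"
    and "\<forall>C\<in>maximal_cliques (carrier (dual_group G)) \<Gamma>. c C \<in> carrier (dual_group G)"
    and "T = (\<Union>C\<in>maximal_cliques (carrier (dual_group G)) \<Gamma>. c C <#\<^bsub>dual_group G\<^esub> C)"
  shows "moment_polytope G S =
    {l \<in> S \<rightarrow>\<^sub>E UNIV.
       \<exists>y \<in> (set_inv\<^bsub>dual_group G\<^esub> T <#>\<^bsub>dual_group G\<^esub> T) \<rightarrow>\<^sub>E UNIV.
         (\<forall>\<psi>\<in>S. y \<psi> = l \<psi>) \<and>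
         y \<one>\<^bsub>dual_group G\<^esub> = 1 \<and>
         hermitian_psd_on T (\<lambda>\<psi> \<psi>'. y (inv\<^bsub>dual_group G\<^esub> \<psi> \<otimes>\<^bsub>dual_group G\<^esub> \<psi>'))}"
    (is "_ = ?R")
proof -
  interpret G: comm_group G by fact
  interpret D: comm_group "dual_group G" using comm_group_dual_group[OF G.is_group] .
  let ?D = "carrier (dual_group G)"
  let ?TT = "set_inv\<^bsub>dual_group G\<^esub> T <#>\<^bsub>dual_group G\<^esub> T"
  let ?d = "\<lambda>\<psi> \<xi>. inv\<^bsub>dual_group G\<^esub> \<psi> \<otimes>\<^bsub>dual_group G\<^esub> \<xi>"
  have finD: "finite ?D"
    by (rule finite_dual_group[OF G.is_group assms(2)])
  have chord: "chordal \<Gamma>" and cayley: "cayley_graph (dual_group G) S \<subseteq> \<Gamma>"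
    using assms(5) by (auto simp: chordal_cover_def)
  have maxD: "C \<subseteq> ?D" if "C \<in> maximal_cliques ?D \<Gamma>" for C
    using that by (auto simp: maximal_cliques_def)
  have translate: "c C \<otimes>\<^bsub>dual_group G\<^esub> \<psi> \<in> T" if "C \<in> maximal_cliques ?D \<Gamma>" "\<psi> \<in> C" for C \<psi>
    using that unfolding assms(7) l_coset_def by blast
  have TD: "T \<subseteq> ?D"
    unfolding assms(7) using maxD assms(6) D.l_coset_subset_G by blast
  \<comment> \<open>Quotients are invariant under a common translation, so the matrix on a clique
    does not depend on the choice of \<open>c\<close>.\<close>
  have diff_translate: "?d (a \<otimes>\<^bsub>dual_group G\<^esub> \<psi>) (a \<otimes>\<^bsub>dual_group G\<^esub> \<xi>) = ?d \<psi> \<xi>"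
    if "a \<in> ?D" "\<psi> \<in> ?D" "\<xi> \<in> ?D" for a \<psi> \<xi>
  proof -
    have "?d (a \<otimes>\<^bsub>dual_group G\<^esub> \<psi>) (a \<otimes>\<^bsub>dual_group G\<^esub> \<xi>) =
        inv\<^bsub>dual_group G\<^esub> \<psi> \<otimes>\<^bsub>dual_group G\<^esub> (inv\<^bsub>dual_group G\<^esub> a \<otimes>\<^bsub>dual_group G\<^esub> (a \<otimes>\<^bsub>dual_group G\<^esub> \<xi>))"
      using that by (simp add: D.inv_mult_group D.m_assoc)
    also have "\<dots> = ?d \<psi> \<xi>"
      using that by (simp add: D.m_assoc[symmetric])
    finally show ?thesis .
  qed
  have TT: "?d \<psi> \<xi> \<in> ?TT" if "\<psi> \<in> T" "\<xi> \<in> T" for \<psi> \<xi>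
    using that by (auto simp: set_mult_def SET_INV_def)
  \<comment> \<open>A vertex or edge lies in a maximal clique, whose translate lies in
    \<open>T\<close> and has the same quotients. Applied at the identity, this puts \<open>S\<close>
    and the trivial character inside \<open>?TT\<close>.\<close>
  have clique_TT: "?d \<psi> \<xi> \<in> ?TT" if \<psi>\<xi>: "\<psi> \<in> ?D" "\<xi> \<in> ?D" "\<psi> = \<xi> \<or> {\<psi>, \<xi>} \<in> \<Gamma>" for \<psi> \<xi>
  proof -
    have "clique {\<psi>, \<xi>} \<Gamma>"
      using \<psi>\<xi>(3) by (auto simp: clique_def insert_commute)
    then obtain C where C: "C \<in> maximal_cliques ?D \<Gamma>" "{\<psi>, \<xi>} \<subseteq> C"
      using clique_subset_maximal_clique[OF finD, of "{\<psi>, \<xi>}" \<Gamma>] \<psi>\<xi>(1,2) by blast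
    have "c C \<otimes>\<^bsub>dual_group G\<^esub> \<psi> \<in> T" "c C \<otimes>\<^bsub>dual_group G\<^esub> \<xi> \<in> T" "c C \<in> ?D"
      using C translate assms(6) by blast+
    then show ?thesis
      using TT diff_translate[of "c C" \<psi> \<xi>] \<psi>\<xi>(1,2) by metis
  qed
  \<comment> \<open>Multiplication by an element of \<open>S\<close> moves along an edge of the
    Cayley graph. The alternative of equality covers the trivial character, which \<open>S\<close>
    may contain.\<close>
  have adj: "\<psi> = \<psi> \<otimes>\<^bsub>dual_group G\<^esub> \<phi> \<or> {\<psi>, \<psi> \<otimes>\<^bsub>dual_group G\<^esub> \<phi>} \<in> \<Gamma>"
    and diff: "?d \<psi> (\<psi> \<otimes>\<^bsub>dual_group G\<^esub> \<phi>) = \<phi>"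
    if "\<psi> \<in> ?D" "\<phi> \<in> S" for \<psi> \<phi>
  proof -
    have \<phi>: "\<phi> \<in> ?D"
      using that assms(3) by blast
    show eq: "?d \<psi> (\<psi> \<otimes>\<^bsub>dual_group G\<^esub> \<phi>) = \<phi>"
      using that \<phi> by (simp add: D.m_assoc[symmetric])
    have "{\<psi>, \<psi> \<otimes>\<^bsub>dual_group G\<^esub> \<phi>} \<in> cayley_graph (dual_group G) S"
      if "\<psi> \<noteq> \<psi> \<otimes>\<^bsub>dual_group G\<^esub> \<phi>"
      unfolding cayley_graph_def using that \<open>\<psi> \<in> ?D\<close> \<open>\<phi> \<in> S\<close> \<phi> eq D.m_closed by fastforce
    then show "\<psi> = \<psi> \<otimes>\<^bsub>dual_group G\<^esub> \<phi> \<or> {\<psi>, \<psi> \<otimes>\<^bsub>dual_group G\<^esub> \<phi>} \<in> \<Gamma>"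
      using cayley by blast
  qed
  have S_TT: "S \<subseteq> ?TT"
  proof
    fix \<phi> assume "\<phi> \<in> S"
    then have "?d \<one>\<^bsub>dual_group G\<^esub> (\<one>\<^bsub>dual_group G\<^esub> \<otimes>\<^bsub>dual_group G\<^esub> \<phi>) \<in> ?TT"
      using clique_TT adj[OF D.one_closed] assms(3) by blast
    then show "\<phi> \<in> ?TT"
      using diff[OF D.one_closed \<open>\<phi> \<in> S\<close>] by simp
  qed
  have one_TT: "\<one>\<^bsub>dual_group G\<^esub> \<in> ?TT"
    using clique_TT[of "\<one>\<^bsub>dual_group G\<^esub>" "\<one>\<^bsub>dual_group G\<^esub>"] by simp
  show ?thesis
  proof (rule subset_antisym; rule subsetI)
    fix l assume "l \<in> moment_polytope G S"
    then obtain \<mu> :: "'a pmf" where \<mu>: "set_pmf \<mu> \<subseteq> carrier G"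
      and l: "l = (\<lambda>\<psi>\<in>S. measure_pmf.expectation \<mu> \<psi>)"
      by (auto simp: moment_polytope_def)
    \<comment> \<open>The witness is the family of all moments of \<open>\<mu>\<close> indexed by
      \<open>?TT\<close>.\<close>
    let ?y = "\<lambda>\<psi>\<in>?TT. measure_pmf.expectation \<mu> \<psi>"
    have "hermitian_psd_on T (\<lambda>\<psi> \<xi>. ?y (?d \<psi> \<xi>))"
      using hermitian_psd_on_expectation[OF G.is_group assms(2) \<mu> TD] TT
      by (subst hermitian_psd_on_cong[where M' = "\<lambda>\<psi> \<xi>. measure_pmf.expectation \<mu> (?d \<psi> \<xi>)"]) auto
    moreover have "?y \<one>\<^bsub>dual_group G\<^esub> = 1"
    proof -
      have "measure_pmf.expectation \<mu> \<one>\<^bsub>dual_group G\<^esub> = (\<Sum>x\<in>carrier G. complex_of_real (pmf \<mu> x))"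
        by (simp add: expectation_finite_support[OF assms(2) \<mu>] one_dual_group)
      also have "\<dots> = 1"
        using sum_pmf_eq_1[OF assms(2) \<mu>] by (simp only: of_real_sum[symmetric] of_real_1)
      finally show ?thesis
        using one_TT by simp
    qed
    moreover have "\<forall>\<psi>\<in>S. ?y \<psi> = l \<psi>"
      using S_TT by (auto simp: l)
    moreover have "?y \<in> ?TT \<rightarrow>\<^sub>E UNIV" "l \<in> S \<rightarrow>\<^sub>E UNIV"
      by (auto simp: l)
    ultimately show "l \<in> ?R"
      by blast
  next
    fix l assume "l \<in> ?R"
    then obtain y where l: "l \<in> S \<rightarrow>\<^sub>E UNIV" and y: "\<forall>\<psi>\<in>S. y \<psi> = l \<psi>" "y \<one>\<^bsub>dual_group G\<^esub> = 1"
        "hermitian_psd_on T (\<lambda>\<psi> \<xi>. y (?d \<psi> \<xi>))"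
      by blast
    have "hermitian_psd_on K (\<lambda>\<psi> \<xi>. y (?d \<psi> \<xi>))" if K: "K \<subseteq> ?D" "clique K \<Gamma>" for K
    proof -
      obtain C where C: "C \<in> maximal_cliques ?D \<Gamma>" "K \<subseteq> C"
        using clique_subset_maximal_clique[OF finD K] by blast
      have cC: "c C \<in> ?D" and "C \<subseteq> ?D"
        using C assms(6) maxD by blast+
      have "hermitian_psd_on K (\<lambda>\<psi> \<xi>. y (?d (c C \<otimes>\<^bsub>dual_group G\<^esub> \<psi>) (c C \<otimes>\<^bsub>dual_group G\<^esub> \<xi>)))"
      proof (rule hermitian_psd_on_reindex[OF y(3)])
        show "inj_on ((\<otimes>\<^bsub>dual_group G\<^esub>) (c C)) K"
          using inj_on_subset[OF D.inj_on_cmult[OF cC] K(1)] .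
        show "(\<otimes>\<^bsub>dual_group G\<^esub>) (c C) ` K \<subseteq> T"
          using translate C by blast
        show "finite T"
          using finite_subset[OF TD finD] .
      qed
      then show ?thesis
        using K(1) diff_translate[OF cC]
        by (subst (asm) hermitian_psd_on_cong[where M' = "\<lambda>\<psi> \<xi>. y (?d \<psi> \<xi>)"]) (auto simp: subset_iff)
    qed
    from chordal_psd_completion[OF finD chord this] obtain M where M: "hermitian_psd_on ?D M"
        "\<And>\<psi> \<xi>. \<psi> \<in> ?D \<Longrightarrow> \<xi> \<in> ?D \<Longrightarrow> \<psi> = \<xi> \<or> {\<psi>, \<xi>} \<in> \<Gamma> \<Longrightarrow> M \<psi> \<xi> = y (?d \<psi> \<xi>)"
      by blast
    have "M \<psi> \<psi> = 1" if "\<psi> \<in> ?D" for \<psi>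
      using M(2)[OF that that] that y(2) by simp
    then obtain \<mu> where \<mu>: "set_pmf \<mu> \<subseteq> carrier G" "\<And>\<phi>. \<phi> \<in> ?D \<Longrightarrow>
        measure_pmf.expectation \<mu> \<phi> = (\<Sum>\<psi>\<in>?D. M \<psi> (\<psi> \<otimes>\<^bsub>dual_group G\<^esub> \<phi>)) / of_nat (card ?D)"
      using psd_on_dual_group_moments[OF G.is_group assms(2) M(1)] by blast
    have "measure_pmf.expectation \<mu> \<phi> = l \<phi>" if "\<phi> \<in> S" for \<phi>
    proof -
      have \<phi>: "\<phi> \<in> ?D"
        using that assms(3) by blast
      \<comment> \<open>For \<open>\<phi>\<close> in \<open>S\<close> every term of the translation
        average is a prescribed entry with the same quotient \<open>\<phi>\<close>, so averaging
        leaves \<open>l \<phi>\<close> unchanged.\<close>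
      have "M \<psi> (\<psi> \<otimes>\<^bsub>dual_group G\<^esub> \<phi>) = l \<phi>" if "\<psi> \<in> ?D" for \<psi>
        using M(2)[of \<psi> "\<psi> \<otimes>\<^bsub>dual_group G\<^esub> \<phi>"] adj[of \<psi> \<phi>] diff[of \<psi> \<phi>] that \<phi> \<open>\<phi> \<in> S\<close> y(1) by simp
      moreover have "card ?D \<noteq> 0"
        using finD D.one_closed by auto
      ultimately show ?thesis
        by (simp add: \<mu>(2)[OF \<phi>])
    qed
    then have "l = (\<lambda>\<psi>\<in>S. measure_pmf.expectation \<mu> \<psi>)"
      using l by (intro extensionalityI[of _ S]) (auto simp: PiE_def)
    then show "l \<in> moment_polytope G S"
      using \<mu>(1) by (auto simp: moment_polytope_def)
  qed
qed

end
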